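(* Let $p$ be a prime and let $\xi$ be a $\mathbb{Z}$-valued random variable. Assume that there is an $\alpha\in(0,1)$ such that $\mathbb{P}(\xi\equiv0 \bmod p)=\alpha$ and $\mathbb{P}(\xi\equiv i\bmod p)=\frac{1-\alpha}{p-1}$ for $i=1,2,\dots,p-1$. For each $n\ge1$, let $L_n$ be an $n\times n$ random lower triangular matrix whose entries on and below the diagonal are i.i.d. copies of $\xi$ (and whose entries above the diagonal are $0$), and let $$\chi_0=\lim_{n\to\infty}\mathbb{E}\left|\{v\in\mathbb{F}_p^n : v_1\neq0,\ L_nv=0\}\right|$$ (this limit exists and $0<\chi_0<\infty$). Then $$\chi_0=\frac{p-1}{p}\prod_{i=1}^\infty\frac{(p-1)\beta_i}{p-\beta_i},\qquad\text{where}\qquad \beta_i=1+(p-1)\left(\frac{p\alpha-1}{p-1}\right)^i.$$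
   Context: The equation $L_nv=0$ for $v\in\mathbb{F}_p^n$ is understood with the entries of $L_n$ reduced mod $p$. *)

theory Defs
  imports
    "HOL-Probability.Probability"
    "Jordan_Normal_Form.Matrix"
    "Berlekamp_Zassenhaus.Finite_Field"
begin

hide_type (open) Finite_Cartesian_Product.vec
unbundle no vec_syntax

definition iid_lower_triangular ::
    "'b measure \<Rightarrow> ('b \<Rightarrow> int) \<Rightarrow> 'a measure \<Rightarrow> nat \<Rightarrow> ('a \<Rightarrow> int mat) \<Rightarrow> bool" where
  "iid_lower_triangular N \<xi> M n L \<longleftrightarrow>
     (\<forall>\<omega>\<in>space M. L \<omega> \<in> carrier_mat n n) \<and>
     (\<forall>\<omega>\<in>space M. \<forall>i<n. \<forall>j<n. i < j \<longrightarrow> L \<omega> $$ (i, j) = 0) \<and>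
     prob_space.indep_vars M (\<lambda>_. count_space UNIV) (\<lambda>ij \<omega>. L \<omega> $$ ij)
       {(i, j). j \<le> i \<and> i < n} \<and>
     (\<forall>i<n. \<forall>j\<le>i. distr M (count_space UNIV) (\<lambda>\<omega>. L \<omega> $$ (i, j)) =
                      distr N (count_space UNIV) \<xi>)"

text \<open>Vectors are indexed from \<open>0\<close>, so the first coordinate is \<open>v $ 0\<close>. The type
  \<open>'p mod_ring\<close> is the field with \<open>CARD('p)\<close> elements, and \<open>map_mat of_int\<close> reduces an integer
  matrix modulo \<open>CARD('p)\<close>.\<close>

definition kernel_vecs :: "nat \<Rightarrow> int mat \<Rightarrow> 'p::prime_card mod_ring vec set" where
  "kernel_vecs n A = {v \<in> carrier_vec n. v $ 0 \<noteq> 0 \<and> map_mat of_int A *\<^sub>v v = 0\<^sub>v n}"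

definition expected_count ::
    "'p::prime_card itself \<Rightarrow> (nat \<Rightarrow> 'a measure) \<Rightarrow> (nat \<Rightarrow> 'a \<Rightarrow> int mat) \<Rightarrow> nat \<Rightarrow> real" where
  "expected_count TYPE('p) M L n =
     prob_space.expectation (M n) (\<lambda>\<omega>. real (card (kernel_vecs n (L n \<omega>) :: 'p mod_ring vec set)))"

definition chi0 ::
    "'p::prime_card itself \<Rightarrow> (nat \<Rightarrow> 'a measure) \<Rightarrow> (nat \<Rightarrow> 'a \<Rightarrow> int mat) \<Rightarrow> real" where
  "chi0 TYPE('p) M L = lim (expected_count TYPE('p) M L)"

definition \<beta> :: "nat \<Rightarrow> real \<Rightarrow> nat \<Rightarrow> real" where
  "\<beta> p \<alpha> i = 1 + (real p - 1) * ((real p * \<alpha> - 1) / (real p - 1)) ^ i"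

end

theory Submission
  imports Defs
begin

text \<open>
  A vector \<open>v\<close> with \<open>v\<^sub>0 \<noteq> 0\<close> lies in the kernel exactly when every row of the matrix is orthogonal
  to it. The rows are independent, and row \<open>i\<close> pairs with \<open>v\<close> to a sum of \<open>k\<close> independent copies of
  \<open>\<xi>\<close>, each multiplied by a unit, where \<open>k\<close> counts the nonzero entries among \<open>v\<^sub>0, \<dots>, v\<^sub>i\<close>. Modulo \<open>p\<close>
  the law of \<open>\<xi>\<close> is \<open>r \<delta>\<^sub>0 + (1 - r) u\<close>, where \<open>u\<close> is the uniform law and \<open>r = (p \<alpha> - 1) / (p - 1)\<close>
  may be negative. Such signed mixtures convolve by multiplying their parameters, so the sum
  vanishes with probability \<open>r\<^sup>k + (1 - r\<^sup>k) / p = \<beta>\<^sub>k / p\<close>. Hence the expected number of kernel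
  vectors is \<open>\<Sum>\<^sub>v \<Prod>\<^sub>i \<beta>\<^bsub>k(i)\<^esub> / p\<close>, a sum that sees \<open>v\<close> only through its running weights \<open>k(i)\<close>
  (\<open>prob_in_kernel\<close>, \<open>expected_count_eq_step_operator\<close>).

  Adding one coordinate leaves the weight unchanged in one way and raises it in \<open>p - 1\<close> ways. The
  expectation is therefore an iterate of one positive linear operator \<open>T\<close> on functions of the
  weight, applied to the constant function \<open>1\<close>. Write \<open>c\<^sub>k = (p - 1) \<beta>\<^sub>k / (p - \<beta>\<^sub>k)\<close> for the factors
  of the claimed product. For a vector with independent uniform coordinates, the weight stays at
  level \<open>k\<close> for a geometric time, and \<open>c\<^sub>k\<close> is the mean of \<open>\<beta>\<^sub>k\<close> raised to that time; this is where
  the product comes from. To turn this into a limit without dominating the random product, observe that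
  \<open>1 / H\<close> with \<open>H k = \<beta>\<^sub>k c\<^sub>1 \<dots> c\<^bsub>k-1\<^esub>\<close> is a fixed point of \<open>T\<close>, and that \<open>H k\<close> tends to the
  infinite product \<open>P\<close>. So the iterates of \<open>T\<close> on \<open>1\<close> and on \<open>P / H\<close> differ by those on a function
  tending to \<open>0\<close>, whose contribution dies out because the mass at each fixed weight does
  (\<open>summable_step_operator_point_mass\<close>). The iterates on \<open>P / H\<close> are constant, and their value gives
  the formula (\<open>step_operator_funpow_tendsto\<close>).
\<close>

section \<open>Linear combinations of independent residues\<close>

text \<open>
  The mass function of \<open>r\<^sup>k \<delta>\<^sub>0 + (1 - r\<^sup>k) u\<close> with \<open>u\<close> uniform. Here \<open>r\<close> may be negative, so this is a
  mixture only in the signed sense.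
\<close>

definition mixture_mass :: "real \<Rightarrow> nat \<Rightarrow> 'p::prime_card mod_ring \<Rightarrow> real" where
  "mixture_mass r k c = 1 / CARD('p) + r ^ k * (of_bool (c = 0) - 1 / CARD('p))"

text \<open>
  Convolving with \<open>u\<close> gives \<open>u\<close>, so the coefficients of \<open>\<delta>\<^sub>0\<close> multiply. Scaling the second variable
  by a unit \<open>v\<close> changes nothing because both \<open>\<delta>\<^sub>0\<close> and \<open>u\<close> are invariant under it.
\<close>

lemma mixture_mass_convolution:
  fixes v c :: "'p::prime_card mod_ring"
  assumes "v \<noteq> 0"
  shows "(\<Sum>d\<in>UNIV. mixture_mass r k (c - d * v) * mixture_mass r 1 d) = mixture_mass r (Suc k) c"
proof -
  define q where "q = real CARD('p)"
  have q: "q \<noteq> 0" "(\<Sum>d\<in>(UNIV :: 'p mod_ring set). 1) = q"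
    by (simp_all add: q_def)
  have hit: "c - d * v = 0 \<longleftrightarrow> d = c / v" for d
    using assms by (auto simp: field_simps)
  have "(\<Sum>d\<in>UNIV. mixture_mass r k (c - d * v) * mixture_mass r 1 d) =
      (\<Sum>d\<in>(UNIV :: 'p mod_ring set). (1 - r ^ k) * (1 - r) / q\<^sup>2 * 1
        + (1 - r ^ k) * r / q * of_bool (d = 0) + (1 - r) * r ^ k / q * of_bool (d = c / v)
        + r ^ k * r * (of_bool (d = 0) * of_bool (c = 0)))"
    using assms
    by (intro sum.cong refl)
      (auto simp: mixture_mass_def hit q_def [symmetric] power2_eq_square algebra_simps add_divide_distrib diff_divide_distrib)
  also have "\<dots> = (1 - r ^ k) * (1 - r) / q\<^sup>2 * q + (1 - r ^ k) * r / q + (1 - r) * r ^ k / q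
      + r ^ k * r * of_bool (c = 0)"
    unfolding sum.distrib sum_distrib_left [symmetric] q(2)
    by (simp add: of_bool_def sum.If_cases flip: sum_distrib_right)
  also have "\<dots> = mixture_mass r (Suc k) c"
    using q(1) by (simp add: mixture_mass_def q_def [symmetric] field_simps power2_eq_square)
  finally show ?thesis .
qed

text \<open>
  Each nonzero coefficient contributes one convolution, and a zero coefficient contributes none.
  The empty sum is \<open>0\<close>, the case \<open>k = 0\<close>.
\<close>

lemma (in prob_space) prob_linear_combination:
  fixes X :: "'i \<Rightarrow> 'a \<Rightarrow> 'p::prime_card mod_ring" and v :: "'i \<Rightarrow> 'p mod_ring"
  assumes "finite J" and indep: "indep_vars (\<lambda>_. count_space UNIV) X J"
    and X: "\<And>j c. j \<in> J \<Longrightarrow> prob {\<omega> \<in> space M. X j \<omega> = c} = mixture_mass r 1 c"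
  shows "prob {\<omega> \<in> space M. (\<Sum>j\<in>J. X j \<omega> * v j) = c} = mixture_mass r (card {j \<in> J. v j \<noteq> 0}) c"
  using assms
proof (induction J arbitrary: c rule: finite_induct)
  case empty
  have "prob {\<omega> \<in> space M. (0 :: 'p mod_ring) = c} = of_bool (c = 0)"
    by (auto simp: prob_space)
  then show ?case by (simp add: mixture_mass_def)
next
  case (insert i J)
  define Z where "Z \<omega> = (\<Sum>j\<in>J. X j \<omega> * v j)" for \<omega>
  have IH: "prob {\<omega> \<in> space M. Z \<omega> = c} = mixture_mass r (card {j \<in> J. v j \<noteq> 0}) c" for c
    unfolding Z_def by (rule insert.IH) (use insert.prems(2) indep_vars_subset [OF insert.prems(1)] in auto)
  show ?case
  proof (cases "v i = 0")
    case True
    then have "{j \<in> insert i J. v j \<noteq> 0} = {j \<in> J. v j \<noteq> 0}" by auto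
    then show ?thesis using True IH insert.hyps by (simp add: Z_def)
  next
    case False
    let ?f = "\<lambda>x. \<Sum>j\<in>J. x j * v j"
    \<comment> \<open>A finite product of countable discrete spaces is discrete, so every function on it is
      measurable.\<close>
    have "indep_var (count_space UNIV) ((\<lambda>f. f i) \<circ> (\<lambda>\<omega>. restrict (\<lambda>i. X i \<omega>) {i}))
        (count_space UNIV) (?f \<circ> (\<lambda>\<omega>. restrict (\<lambda>i. X i \<omega>) J))"
      using insert.hyps
      by (intro indep_var_compose [OF indep_var_restrict [OF insert.prems(1)]])
        (auto simp: count_space_PiM_finite [where B = "\<lambda>_. UNIV"] countable_finite)
    also have "(\<lambda>f. f i) \<circ> (\<lambda>\<omega>. restrict (\<lambda>i. X i \<omega>) {i}) = X i" by auto
    also have "?f \<circ> (\<lambda>\<omega>. restrict (\<lambda>i. X i \<omega>) J) = Z"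
      by (auto simp: Z_def)
    finally have ind: "indep_var (count_space UNIV) (X i) (count_space UNIV) Z" .
    have [measurable]: "X i \<in> measurable M (count_space UNIV)" "Z \<in> measurable M (count_space UNIV)"
      using indep_var_rv1 [OF ind] indep_var_rv2 [OF ind] by auto
    have "{\<omega> \<in> space M. (\<Sum>j\<in>insert i J. X j \<omega> * v j) = c} =
        (\<Union>d\<in>UNIV. {\<omega> \<in> space M. X i \<omega> \<in> {d} \<and> Z \<omega> \<in> {c - d * v i}})"
      using insert.hyps by (auto simp: Z_def)
    also have "prob \<dots> = (\<Sum>d\<in>UNIV. prob {\<omega> \<in> space M. X i \<omega> \<in> {d} \<and> Z \<omega> \<in> {c - d * v i}})"
      by (rule finite_measure_finite_Union) (auto simp: disjoint_family_on_def)
    also have "\<dots> = (\<Sum>d\<in>UNIV. mixture_mass r (card {j \<in> J. v j \<noteq> 0}) (c - d * v i) * mixture_mass r 1 d)"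
      by (intro sum.cong refl, subst prob_indep_random_variable [OF ind])
        (use IH insert.prems in auto)
    also have "\<dots> = mixture_mass r (Suc (card {j \<in> J. v j \<noteq> 0})) c"
      by (rule mixture_mass_convolution) fact
    also have "Suc (card {j \<in> J. v j \<noteq> 0}) = card {j \<in> insert i J. v j \<noteq> 0}"
    proof -
      have "{j \<in> insert i J. v j \<noteq> 0} = insert i {j \<in> J. v j \<noteq> 0}" using False by auto
      then show ?thesis using insert.hyps by simp
    qed
    finally show ?thesis .
  qed
qed

text \<open>
  Different rows use disjoint sets of matrix entries, so the events that a row annihilates \<open>v\<close>
  are independent.
\<close>

lemma (in prob_space) prob_in_kernel:
  fixes L :: "'a \<Rightarrow> int mat" and v :: "'p::prime_card mod_ring vec"
  assumes L: "iid_lower_triangular N \<xi> M n L" and n: "n \<ge> 1"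
    and xi: "\<xi> \<in> measurable N (count_space UNIV)"
    and mass: "\<And>c. measure N {\<omega> \<in> space N. (of_int (\<xi> \<omega>) :: 'p mod_ring) = c} = mixture_mass r 1 c"
    and v: "v \<in> carrier_vec n"
  shows "{\<omega> \<in> space M. map_mat of_int (L \<omega>) *\<^sub>v v = 0\<^sub>v n} \<in> events" (is "?E \<in> _")
    and "prob {\<omega> \<in> space M. map_mat of_int (L \<omega>) *\<^sub>v v = 0\<^sub>v n} =
      (\<Prod>i<n. mixture_mass r (card {j. j \<le> i \<and> v $ j \<noteq> 0}) (0 :: 'p mod_ring))"
proof -
  define X where "X ij \<omega> = (of_int (L \<omega> $$ ij) :: 'p mod_ring)" for ij \<omega>
  define T where "T = {(i, j). j \<le> i \<and> i < n}"
  have indL: "indep_vars (\<lambda>_. count_space UNIV) (\<lambda>ij \<omega>. L \<omega> $$ ij) T"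
    using L by (simp add: iid_lower_triangular_def T_def)
  then have indX: "indep_vars (\<lambda>_. count_space UNIV) X T"
    unfolding X_def by (rule indep_vars_compose2) auto
  have X: "prob {\<omega> \<in> space M. X (i, j) \<omega> = c} = mixture_mass r 1 c" if "j \<le> i" "i < n" for i j c
  proof -
    have rv: "(\<lambda>\<omega>. L \<omega> $$ (i, j)) \<in> measurable M (count_space UNIV)"
      using indL that by (auto simp: indep_vars_def T_def)
    have "prob {\<omega> \<in> space M. X (i, j) \<omega> = c} =
        measure (distr M (count_space UNIV) (\<lambda>\<omega>. L \<omega> $$ (i, j))) {x. (of_int x :: 'p mod_ring) = c}"
      by (subst measure_distr [OF rv]) (auto simp: X_def intro!: arg_cong [where f = prob])
    also have "\<dots> = measure (distr N (count_space UNIV) \<xi>) {x. (of_int x :: 'p mod_ring) = c}"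
      using L that by (simp add: iid_lower_triangular_def)
    also have "\<dots> = measure N {\<omega> \<in> space N. (of_int (\<xi> \<omega>) :: 'p mod_ring) = c}"
      by (subst measure_distr [OF xi]) (auto intro!: arg_cong [where f = "measure N"])
    finally show ?thesis by (simp add: mass)
  qed
  define R where "R i \<omega> = (\<Sum>ij\<in>Pair i ` {..i}. X ij \<omega> * v $ snd ij)" for i \<omega>
  \<comment> \<open>Group the entries by rows: the index set of row \<open>i\<close> is \<open>Pair i ` {..i}\<close>.\<close>
  have "indep_vars (\<lambda>i. PiM (Pair i ` {..i}) (\<lambda>_. count_space UNIV))
      (\<lambda>i \<omega>. restrict (\<lambda>ij. X ij \<omega>) (Pair i ` {..i})) {..<n}"
    by (rule indep_vars_restrict [OF indX]) (auto simp: T_def disjoint_family_on_def)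
  then have "indep_vars (\<lambda>_. count_space UNIV)
      (\<lambda>i \<omega>. (\<lambda>x. \<Sum>ij\<in>Pair i ` {..i}. x ij * v $ snd ij) (restrict (\<lambda>ij. X ij \<omega>) (Pair i ` {..i}))) {..<n}"
    by (rule indep_vars_compose2) (auto simp: count_space_PiM_finite [where B = "\<lambda>_. UNIV"] countable_finite)
  then have indR: "indep_vars (\<lambda>_. count_space UNIV) R {..<n}"
    by (simp add: R_def [abs_def] cong: sum.cong)
  then have rvR: "R i \<in> measurable M (count_space UNIV)" if "i < n" for i
    using that by (auto simp: indep_vars_def)
  have R: "prob (R i -` {0} \<inter> space M) = mixture_mass r (card {j. j \<le> i \<and> v $ j \<noteq> 0}) (0 :: 'p mod_ring)" if "i < n" for i
  proof -
    have "prob {\<omega> \<in> space M. (\<Sum>ij\<in>Pair i ` {..i}. X ij \<omega> * v $ snd ij) = 0} =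
        mixture_mass r (card {ij \<in> Pair i ` {..i}. v $ snd ij \<noteq> 0}) (0 :: 'p mod_ring)"
      using that by (intro prob_linear_combination indep_vars_subset [OF indX]) (auto simp: T_def X)
    moreover have "card {ij \<in> Pair i ` {..i}. v $ snd ij \<noteq> 0} = card {j. j \<le> i \<and> v $ j \<noteq> 0}"
    proof -
      have "{ij \<in> Pair i ` {..i}. v $ snd ij \<noteq> 0} = Pair i ` {j. j \<le> i \<and> v $ j \<noteq> 0}" by auto
      then show ?thesis by (simp add: card_image inj_on_def)
    qed
    moreover have "{\<omega> \<in> space M. (\<Sum>ij\<in>Pair i ` {..i}. X ij \<omega> * v $ snd ij) = 0} = R i -` {0} \<inter> space M"
      by (auto simp: R_def)
    ultimately show ?thesis by simp
  qed
  have row: "(map_mat of_int (L \<omega>) *\<^sub>v v) $ i = R i \<omega>" if "\<omega> \<in> space M" "i < n" for i \<omega>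
  proof -
    have dim: "L \<omega> \<in> carrier_mat n n" and upper: "\<And>j. i < j \<Longrightarrow> j < n \<Longrightarrow> L \<omega> $$ (i, j) = 0"
      using L that by (auto simp: iid_lower_triangular_def)
    have "(map_mat of_int (L \<omega>) *\<^sub>v v) $ i = (\<Sum>j\<in>{0..<n}. X (i, j) \<omega> * v $ j)"
      using dim v that(2) by (auto simp: scalar_prod_def X_def intro!: sum.cong)
    also have "\<dots> = (\<Sum>j\<in>{..i}. X (i, j) \<omega> * v $ j)"
      using that(2) by (intro sum.mono_neutral_right) (auto simp: X_def upper)
    also have "\<dots> = R i \<omega>"
      by (simp add: R_def sum.reindex inj_on_def)
    finally show ?thesis .
  qed
  have E: "?E = (\<Inter>i\<in>{..<n}. R i -` {0} \<inter> space M)"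
  proof -
    have "map_mat of_int (L \<omega>) *\<^sub>v v = 0\<^sub>v n \<longleftrightarrow> (\<forall>i<n. R i \<omega> = 0)" if "\<omega> \<in> space M" for \<omega>
    proof -
      have "L \<omega> \<in> carrier_mat n n" using L that by (auto simp: iid_lower_triangular_def)
      then show ?thesis using row [OF that] by (auto simp: vec_eq_iff)
    qed
    then show ?thesis using n by (auto simp: Suc_le_eq)
  qed
  show "?E \<in> events"
    unfolding E using rvR n by (intro sets.finite_INT) (auto simp: lessThan_empty_iff intro: measurable_sets)
  show "prob ?E = (\<Prod>i<n. mixture_mass r (card {j. j \<le> i \<and> v $ j \<noteq> 0}) (0 :: 'p mod_ring))"
    unfolding E using n R by (subst indep_varsD_finite [OF indR]) (auto simp: lessThan_empty_iff)
qed

section \<open>The limit of the iterated weight operator\<close>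

text \<open>
  The operator describes one new coordinate of a vector: the value \<open>0\<close> keeps the weight \<open>k\<close>, each of the
  \<open>q - 1\<close> other values raises it by one, and arriving at weight \<open>j\<close> costs a factor \<open>b j\<close>. In the
  application the argument is one less than the number of nonzero entries, since the first entry
  never vanishes, so \<open>b k\<close> is \<open>\<beta>\<^bsub>k+1\<^esub> / p\<close>.
\<close>

definition step_operator :: "real \<Rightarrow> (nat \<Rightarrow> real) \<Rightarrow> (nat \<Rightarrow> real) \<Rightarrow> nat \<Rightarrow> real" where
  "step_operator q b f k = b k * f k + (q - 1) * b (Suc k) * f (Suc k)"

lemma step_operator_funpow_linear:
  "(step_operator q b ^^ n) (\<lambda>k. x * f k + y * g k) =
    (\<lambda>k. x * (step_operator q b ^^ n) f k + y * (step_operator q b ^^ n) g k)"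
  by (induction n) (auto simp: step_operator_def fun_eq_iff algebra_simps)

lemma step_operator_funpow_cmult:
  "(step_operator q b ^^ n) (\<lambda>k. x * f k) k = x * (step_operator q b ^^ n) f k"
  by (induction n arbitrary: k) (simp_all add: step_operator_def algebra_simps)

lemma step_operator_funpow_sum:
  "(step_operator q b ^^ n) (\<lambda>k. \<Sum>j\<in>J. f j k) k = (\<Sum>j\<in>J. (step_operator q b ^^ n) (f j) k)"
proof (induction n arbitrary: k)
  case (Suc n)
  then show ?case by (simp add: step_operator_def sum.distrib sum_distrib_left)
qed simp

lemma step_operator_funpow_mono:
  assumes "1 \<le> q" "\<And>k. 0 \<le> b k" "\<And>k. f k \<le> g k"
  shows "(step_operator q b ^^ n) f k \<le> (step_operator q b ^^ n) g k"
proof (induction n arbitrary: k)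
  case (Suc n)
  then show ?case using assms
    by (simp add: step_operator_def) (intro add_mono mult_left_mono; simp)
qed (use assms in simp)

text \<open>
  Summing the recursion bounds every partial sum \<open>S\<close> by \<open>x\<^sub>0 + r S + \<Sum>y\<close>, and \<open>r < 1\<close> allows solving
  for \<open>S\<close>.
\<close>

lemma summable_of_affine_recursion:
  fixes x y :: "nat \<Rightarrow> real"
  assumes rec: "\<And>n. x (Suc n) = r * x n + y n"
    and "0 \<le> r" "r < 1" and x: "\<And>n. 0 \<le> x n" and y: "\<And>n. 0 \<le> y n" "summable y"
  shows "summable x"
proof (rule bounded_imp_summable)
  fix N
  have "(\<Sum>n\<le>N. x n) \<le> x 0 + (\<Sum>n<Suc N. x (Suc n))"
    unfolding lessThan_Suc_atMost using sum.atMost_Suc_shift [of x N] x [of "Suc N"] by simp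
  also have "\<dots> = x 0 + (r * (\<Sum>n\<le>N. x n) + (\<Sum>n\<le>N. y n))"
    by (simp only: rec lessThan_Suc_atMost sum.distrib sum_distrib_left)
  also have "\<dots> \<le> x 0 + (r * (\<Sum>n\<le>N. x n) + suminf y)"
    using y by (intro add_mono order.refl sum_le_suminf) auto
  finally show "(\<Sum>n\<le>N. x n) \<le> (x 0 + suminf y) / (1 - r)"
    using assms(3) by (simp add: field_simps)
qed (use x in simp)

text \<open>
  Paths cannot linger at a fixed weight \<open>j\<close>: each further step there costs the factor \<open>b j < 1\<close>.
  Applying the operator to the indicator of \<open>j\<close> returns \<open>b j\<close> times that indicator plus a multiple of
  the indicator of \<open>j - 1\<close>, which makes induction on \<open>j\<close> possible.
\<close>

lemma summable_step_operator_point_mass: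
  assumes "1 \<le> q" and b: "\<And>k. 0 < b k" "\<And>k. b k < 1"
  shows "summable (\<lambda>n. (step_operator q b ^^ n) (\<lambda>k. of_bool (k = j)) 0)"
proof -
  let ?T = "step_operator q b"
  have nonneg: "0 \<le> (?T ^^ n) (\<lambda>k. of_bool (k = j)) i" for n j i
  proof -
    have "(?T ^^ n) (\<lambda>k. 0 * 0) i \<le> (?T ^^ n) (\<lambda>k. of_bool (k = j)) i"
      using assms by (intro step_operator_funpow_mono) (auto intro: less_imp_le)
    then show ?thesis unfolding step_operator_funpow_cmult by simp
  qed
  show ?thesis
  proof (induction j)
    case 0
    have "?T (\<lambda>k. of_bool (k = 0)) = (\<lambda>k. b 0 * of_bool (k = 0))"
      by (auto simp: step_operator_def fun_eq_iff intro: gr0I)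
    then have "(?T ^^ Suc n) (\<lambda>k. of_bool (k = 0)) 0 =
        b 0 * (?T ^^ n) (\<lambda>k. of_bool (k = 0)) 0 + 0" for n
      by (simp only: funpow_Suc_right o_apply step_operator_funpow_cmult add_0_right)
    then show ?case
      by (rule summable_of_affine_recursion) (use b nonneg in \<open>auto intro: less_imp_le\<close>)
  next
    case (Suc j)
    have "?T (\<lambda>k. of_bool (k = Suc j)) =
        (\<lambda>k. b (Suc j) * of_bool (k = Suc j) + (q - 1) * b (Suc j) * of_bool (k = j))"
      by (auto simp: step_operator_def fun_eq_iff)
    then have "(?T ^^ Suc n) (\<lambda>k. of_bool (k = Suc j)) 0 =
        b (Suc j) * (?T ^^ n) (\<lambda>k. of_bool (k = Suc j)) 0 +
        (q - 1) * b (Suc j) * (?T ^^ n) (\<lambda>k. of_bool (k = j)) 0" for n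
      by (simp only: funpow_Suc_right o_apply step_operator_funpow_linear)
    then show ?case
      by (rule summable_of_affine_recursion)
        (use b nonneg Suc assms in \<open>auto intro!: mult_nonneg_nonneg summable_mult intro: less_imp_le\<close>)
  qed
qed

text \<open>
  The fixed point \<open>1 / H\<close> of the operator turns the question into one about a function that vanishes
  at infinity. Multiplying \<open>1 / H\<close> by \<open>P\<close> gives a fixed point that approaches \<open>1\<close> for large weights,
  and iterates starting from weight \<open>0\<close> see only large weights in the end.
\<close>

lemma step_operator_funpow_tendsto:
  assumes q: "1 < q" and b: "\<And>k. 0 < b k" "\<And>k. b k < 1" and b_lim: "b \<longlonglongrightarrow> 1 / q"
    and P: "(\<lambda>k. \<Prod>i<k. (q - 1) * b i / (1 - b i)) \<longlonglongrightarrow> P" and "0 < P"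
  shows "(\<lambda>n. (step_operator q b ^^ n) (\<lambda>_. 1) 0) \<longlonglongrightarrow> P / (q * b 0)"
proof -
  define T where "T = step_operator q b"
  define prods where "prods k = (\<Prod>i<k. (q - 1) * b i / (1 - b i))" for k
  define H where "H k = q * b k * prods k" for k
  have prods_pos: "prods k > 0" for k
    unfolding prods_def using q b by (intro prod_pos) (simp add: less_diff_eq)
  then have H_pos: "H k > 0" for k
    unfolding H_def using q b by simp
  have "H \<longlonglongrightarrow> q * (1 / q) * P"
    unfolding H_def prods_def by (intro tendsto_intros b_lim P)
  then have H_lim: "H \<longlonglongrightarrow> P" using q by simp

  \<comment> \<open>The factors of \<open>prods\<close> are exactly those for which this identity holds: it amounts to
    \<open>1 + (1 - b k) / b k = 1 / b k\<close>.\<close>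
  have "T (\<lambda>k. 1 / H k) = (\<lambda>k. 1 / H k)"
  proof
    fix k
    have nz: "b k \<noteq> 0" "b (Suc k) \<noteq> 0" "1 - b k \<noteq> 0" "q \<noteq> 0" "q - 1 \<noteq> 0" "prods k \<noteq> 0"
      using b [of k] b [of "Suc k"] q prods_pos [of k] by auto
    have "prods (Suc k) = prods k * ((q - 1) * b k / (1 - b k))"
      by (simp add: prods_def)
    then have "prods (Suc k) * (1 - b k) = (q - 1) * b k * prods k" "prods (Suc k) \<noteq> 0"
      using nz by simp_all
    then show "T (\<lambda>k. 1 / H k) k = 1 / H k"
      unfolding T_def step_operator_def H_def using nz by (simp add: divide_simps) (simp add: algebra_simps)
  qed
  then have harmonic: "(T ^^ n) (\<lambda>k. 1 / H k) = (\<lambda>k. 1 / H k)" for n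
    by (induction n) auto

  have mono: "(T ^^ n) f k \<le> (T ^^ n) g k" if "\<And>k. f k \<le> g k" for f g n k
    unfolding T_def using that q b by (intro step_operator_funpow_mono) (auto intro: less_imp_le)
  have linear: "(T ^^ n) (\<lambda>k. x * f k + y * g k) k = x * (T ^^ n) f k + y * (T ^^ n) g k" for x y f g n k
    by (simp add: T_def step_operator_funpow_linear)
  have cmult: "(T ^^ n) (\<lambda>k. x * f k) k = x * (T ^^ n) f k" for x f n k
    by (simp add: T_def step_operator_funpow_cmult)

  obtain C where C: "\<And>k. H k \<le> C" "C > 0"
  proof -
    obtain C where "C > 0" "\<And>k. norm (H k) \<le> C"
      using convergent_imp_Bseq [of H] H_lim by (metis BseqE convergentI)
    then show ?thesis using that [of C] by (metis abs_le_D1 real_norm_def)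
  qed
  \<comment> \<open>As \<open>H\<close> is bounded by \<open>C\<close>, the constant \<open>1\<close> lies below \<open>C\<close> times the fixed point.\<close>
  have bounded: "(T ^^ n) (\<lambda>_. 1) 0 \<le> C / H 0" for n
  proof -
    have "(T ^^ n) (\<lambda>_. 1) 0 \<le> (T ^^ n) (\<lambda>k. C * (1 / H k)) 0"
      using C(1) H_pos by (intro mono) (simp add: field_simps)
    then show ?thesis unfolding cmult by (simp add: harmonic)
  qed

  have "(\<lambda>n. (T ^^ n) (\<lambda>_. 1) 0 - P / H 0) \<longlonglongrightarrow> 0"
  proof (rule LIMSEQ_I)
    fix \<epsilon> :: real assume "\<epsilon> > 0"
    define g where "g k = \<bar>1 - P / H k\<bar>" for k
    define \<delta> where "\<delta> = \<epsilon> / (2 * (C / H 0))"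
    have "\<delta> > 0" using \<open>\<epsilon> > 0\<close> C H_pos by (simp add: \<delta>_def)
    have "(\<lambda>k. 1 - P / H k) \<longlonglongrightarrow> 1 - P / P"
      using \<open>0 < P\<close> by (intro tendsto_intros H_lim) auto
    then have "(\<lambda>k. 1 - P / H k) \<longlonglongrightarrow> 0" using \<open>0 < P\<close> by simp
    from LIMSEQ_D [OF this \<open>\<delta> > 0\<close>] obtain K where K: "\<And>k. k \<ge> K \<Longrightarrow> g k < \<delta>"
      by (auto simp: g_def)
    have "(\<lambda>n. \<Sum>j<K. g j * (T ^^ n) (\<lambda>k. of_bool (k = j)) 0) \<longlonglongrightarrow> (\<Sum>j<K. g j * 0)"
      unfolding T_def
      by (intro tendsto_intros summable_LIMSEQ_zero summable_step_operator_point_mass) (use q b in auto)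
    then have "(\<lambda>n. \<Sum>j<K. g j * (T ^^ n) (\<lambda>k. of_bool (k = j)) 0) \<longlonglongrightarrow> 0" by simp
    from LIMSEQ_D [OF this half_gt_zero [OF \<open>\<epsilon> > 0\<close>]] obtain n0
      where n0: "\<And>n. n \<ge> n0 \<Longrightarrow> norm ((\<Sum>j<K. g j * (T ^^ n) (\<lambda>k. of_bool (k = j)) 0) - 0) < \<epsilon> / 2"
      by blast
    \<comment> \<open>Outside the finitely many weights below \<open>K\<close> the difference is uniformly small; at these
      weights the iterates carry vanishing mass.\<close>
    have split_bound: "g k \<le> \<delta> * 1 + 1 * (\<Sum>j<K. g j * of_bool (k = j))" for k
    proof (cases "k < K")
      case True
      then have "(\<Sum>j<K. g j * of_bool (k = j)) = g k" by (simp add: of_bool_def if_distrib sum.delta cong: if_cong)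
      then show ?thesis using \<open>\<delta> > 0\<close> by simp
    next
      case False
      then have "(\<Sum>j<K. g j * of_bool (k = j)) = 0" by (intro sum.neutral) auto
      then show ?thesis using K [of k] False by simp
    qed
    show "\<exists>n0. \<forall>n\<ge>n0. norm ((T ^^ n) (\<lambda>_. 1) 0 - P / H 0 - 0) < \<epsilon>"
    proof (intro exI allI impI)
      fix n assume "n \<ge> n0"
      have "(T ^^ n) (\<lambda>k. 1 - P / H k) 0 = (T ^^ n) (\<lambda>k. 1 * 1 + (- P) * (1 / H k)) 0"
        by simp
      also have "\<dots> = (T ^^ n) (\<lambda>_. 1) 0 - P / H 0"
        by (subst linear) (simp add: harmonic)
      finally have diff: "(T ^^ n) (\<lambda>_. 1) 0 - P / H 0 = (T ^^ n) (\<lambda>k. 1 - P / H k) 0" by simp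
      have "(T ^^ n) (\<lambda>k. 1 - P / H k) 0 \<le> (T ^^ n) g 0"
        by (intro mono) (simp add: g_def)
      moreover have "(T ^^ n) (\<lambda>k. (- 1) * g k) 0 \<le> (T ^^ n) (\<lambda>k. 1 - P / H k) 0"
        by (intro mono) (simp add: g_def)
      ultimately have "\<bar>(T ^^ n) (\<lambda>k. 1 - P / H k) 0\<bar> \<le> (T ^^ n) g 0"
        unfolding cmult by simp
      also have "\<dots> \<le> (T ^^ n) (\<lambda>k. \<delta> * 1 + 1 * (\<Sum>j<K. g j * of_bool (k = j))) 0"
        by (intro mono split_bound)
      also have "\<dots> = \<delta> * (T ^^ n) (\<lambda>_. 1) 0 + (\<Sum>j<K. (T ^^ n) (\<lambda>k. g j * of_bool (k = j)) 0)"
        by (subst linear) (simp only: T_def step_operator_funpow_sum mult_1)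
      also have "\<dots> = \<delta> * (T ^^ n) (\<lambda>_. 1) 0 + (\<Sum>j<K. g j * (T ^^ n) (\<lambda>k. of_bool (k = j)) 0)"
        unfolding cmult ..
      also have "\<dots> < \<delta> * (C / H 0) + \<epsilon> / 2"
      proof (rule add_le_less_mono)
        show "\<delta> * (T ^^ n) (\<lambda>_. 1) 0 \<le> \<delta> * (C / H 0)"
          using bounded \<open>\<delta> > 0\<close> by (intro mult_left_mono) auto
        show "(\<Sum>j<K. g j * (T ^^ n) (\<lambda>k. of_bool (k = j)) 0) < \<epsilon> / 2"
          using le_less_trans [OF abs_ge_self n0 [OF \<open>n \<ge> n0\<close>, unfolded real_norm_def]] by simp
      qed
      also have "\<dots> = \<epsilon>"
        using C H_pos [of 0] by (simp add: \<delta>_def)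
      finally show "norm ((T ^^ n) (\<lambda>_. 1) 0 - P / H 0 - 0) < \<epsilon>"
        by (simp add: diff)
    qed
  qed
  then have "(\<lambda>n. (T ^^ n) (\<lambda>_. 1) 0) \<longlonglongrightarrow> P / H 0"
    by (rule LIM_zero_cancel)
  then show ?thesis by (simp add: H_def prods_def T_def)
qed

section \<open>Summation over vectors\<close>

text \<open>
  The first coordinate is left out because it is nonzero for all vectors in question. With this
  convention the weight starts at \<open>0\<close>.
\<close>

definition tail_weight :: "'p::prime_card mod_ring vec \<Rightarrow> nat \<Rightarrow> nat" where
  "tail_weight v i = card {j. 0 < j \<and> j \<le> i \<and> v $ j \<noteq> 0}"

lemma finite_carrier_vec_finite_type: "finite (carrier_vec n :: 'c::finite vec set)"
proof (rule finite_subset)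
  show "carrier_vec n \<subseteq> vec_of_list ` {xs :: 'c list. set xs \<subseteq> UNIV \<and> length xs = n}"
  proof
    fix v :: "'c vec" assume "v \<in> carrier_vec n"
    then have "v = vec_of_list (list_of_vec v)" "length (list_of_vec v) = n" by (auto simp: vec_list)
    then show "v \<in> vec_of_list ` {xs :: 'c list. set xs \<subseteq> UNIV \<and> length xs = n}" by blast
  qed
  show "finite (vec_of_list ` {xs :: 'c list. set xs \<subseteq> UNIV \<and> length xs = n})"
    by (intro finite_imageI finite_lists_length_eq) simp
qed

text \<open>
  Splitting off the last coordinate applies the operator once to the function of the final weight.
  The factor in front comes from the \<open>q - 1\<close> choices of the first coordinate.
\<close>

lemma sum_vectors_eq_step_operator:
  fixes f b :: "nat \<Rightarrow> real"
  defines "q \<equiv> real CARD('p::prime_card)"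
  shows "(\<Sum>v\<in>{v \<in> carrier_vec (Suc n). v $ 0 \<noteq> (0 :: 'p mod_ring)}.
      (\<Prod>i\<le>n. b (tail_weight v i)) * f (tail_weight v n)) = (q - 1) * b 0 * (step_operator q b ^^ n) f 0"
proof (induction n arbitrary: f)
  case 0
  have tw_0: "tail_weight v 0 = 0" for v :: "'p mod_ring vec"
    by (auto simp: tail_weight_def card_eq_0_iff)
  have "(\<Sum>v\<in>{v \<in> carrier_vec (Suc 0). v $ 0 \<noteq> (0 :: 'p mod_ring)}.
      (\<Prod>i\<le>0. b (tail_weight v i)) * f (tail_weight v 0)) = (\<Sum>c\<in>UNIV - {0 :: 'p mod_ring}. b 0 * f 0)"
    by (rule sum.reindex_bij_witness [where j = "\<lambda>v. v $ 0" and i = "\<lambda>c. vec 1 (\<lambda>_. c)"])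
      (auto simp: tw_0 vec_eq_iff)
  also have "\<dots> = (q - 1) * b 0 * f 0"
    by (simp add: card_Diff_singleton q_def of_nat_diff Suc_leI)
  finally show ?case by simp
next
  case (Suc n)
  define ext where "ext v c = vec (Suc (Suc n)) (\<lambda>i. if i \<le> n then v $ i else c)"
    for v and c :: "'p mod_ring"
  let ?V = "\<lambda>n. {v \<in> carrier_vec (Suc n). v $ 0 \<noteq> (0 :: 'p mod_ring)}"
  have tw: "tail_weight (ext v c) i = tail_weight v i" if "i \<le> n" for v c i
    unfolding tail_weight_def ext_def using that by (intro arg_cong [where f = card]) auto
  have tw_Suc: "tail_weight (ext v c) (Suc n) = (if c = 0 then tail_weight v n else Suc (tail_weight v n))" for v c
  proof -
    have "{j. 0 < j \<and> j \<le> Suc n \<and> ext v c $ j \<noteq> 0} =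
        (if c = 0 then {j. 0 < j \<and> j \<le> n \<and> v $ j \<noteq> 0} else insert (Suc n) {j. 0 < j \<and> j \<le> n \<and> v $ j \<noteq> 0})"
      by (auto simp: ext_def le_Suc_eq)
    then show ?thesis by (simp add: tail_weight_def)
  qed
  have step: "(\<Sum>c\<in>UNIV. b (tail_weight (ext v c) (Suc n)) * f (tail_weight (ext v c) (Suc n))) =
      step_operator q b f (tail_weight v n)" for v
    unfolding tw_Suc step_operator_def
    by (subst sum.remove [of _ 0]) (simp_all add: card_Diff_singleton q_def of_nat_diff Suc_leI)
  have "(\<Sum>v\<in>?V (Suc n). (\<Prod>i\<le>Suc n. b (tail_weight v i)) * f (tail_weight v (Suc n))) =
      (\<Sum>(v, c)\<in>?V n \<times> UNIV. (\<Prod>i\<le>Suc n. b (tail_weight (ext v c) i)) * f (tail_weight (ext v c) (Suc n)))"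
  proof (rule sum.reindex_bij_witness
      [where i = "\<lambda>(v, c). ext v c" and j = "\<lambda>v. (vec (Suc n) (\<lambda>i. v $ i), v $ Suc n)"])
    fix v assume "v \<in> ?V (Suc n)"
    then have "ext (vec (Suc n) (\<lambda>i. v $ i)) (v $ Suc n) = v"
      by (auto simp: ext_def vec_eq_iff le_less_Suc_eq dest!: le_SucE)
    then show "(case (vec (Suc n) (\<lambda>i. v $ i), v $ Suc n) of (v, c) \<Rightarrow> ext v c) = v"
      and "(case (vec (Suc n) (\<lambda>i. v $ i), v $ Suc n) of
        (v, c) \<Rightarrow> (\<Prod>i\<le>Suc n. b (tail_weight (ext v c) i)) * f (tail_weight (ext v c) (Suc n))) =
        (\<Prod>i\<le>Suc n. b (tail_weight v i)) * f (tail_weight v (Suc n))"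
      by simp_all
  qed (auto simp: ext_def vec_eq_iff)
  also have "\<dots> = (\<Sum>v\<in>?V n. (\<Prod>i\<le>n. b (tail_weight v i)) * step_operator q b f (tail_weight v n))"
    unfolding sum.cartesian_product [symmetric] step [symmetric]
    by (simp add: tw sum_distrib_left mult.assoc)
  also have "\<dots> = (q - 1) * b 0 * (step_operator q b ^^ Suc n) f 0"
    unfolding Suc.IH by (simp only: funpow_Suc_right o_apply)
  finally show ?case .
qed

section \<open>The expected number of kernel vectors\<close>

text \<open>
  A law on \<open>\<int>/p\<close> that is constant on the nonzero residues is a combination of \<open>\<delta>\<^sub>0\<close> and \<open>u\<close>; the value
  of \<open>r\<close> is forced by \<open>\<alpha> = r + (1 - r) / q\<close>.
\<close>

lemma mixture_mass_of_uniform_nonzero_residues: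
  fixes c :: "'p::prime_card mod_ring" and \<alpha> :: real
  defines "q \<equiv> real CARD('p)"
  defines "r \<equiv> (q * \<alpha> - 1) / (q - 1)"
  assumes zero: "measure N {\<omega> \<in> space N. [\<xi> \<omega> = 0] (mod int CARD('p))} = \<alpha>"
    and nonzero: "\<And>i. i \<in> {1..CARD('p) - 1} \<Longrightarrow>
      measure N {\<omega> \<in> space N. [\<xi> \<omega> = int i] (mod int CARD('p))} = (1 - \<alpha>) / (q - 1)"
  shows "measure N {\<omega> \<in> space N. of_int (\<xi> \<omega>) = c} = mixture_mass r 1 c"
proof -
  have q: "q > 1" using prime_card [where 'a = 'p] prime_gt_1_nat by (auto simp: q_def)
  obtain i where i: "i < CARD('p)" "c = of_nat i" using surj_of_nat_mod_ring [of c] by blast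
  have "(of_int x = c) = [x = int i] (mod int CARD('p))" for x
    using of_int_eq_iff_cong_CHAR [where 'a = "'p mod_ring", of x "int i"] by (simp add: i)
  then have event: "measure N {\<omega> \<in> space N. of_int (\<xi> \<omega>) = c} =
      measure N {\<omega> \<in> space N. [\<xi> \<omega> = int i] (mod int CARD('p))}"
    by simp
  show ?thesis
  proof (cases "i = 0")
    case True
    then show ?thesis
      using q zero unfolding event
      by (simp add: mixture_mass_def i(2) r_def q_def [symmetric] field_simps)
  next
    case False
    then have "c \<noteq> 0"
      using i of_nat_0_mod_ring_dvd [where 'a = 'p, of i] nat_dvd_not_less [of i "CARD('p)"] by auto
    moreover have "i \<in> {1..CARD('p) - 1}" using False i by auto
    moreover have "1 - r = q * (1 - \<alpha>) / (q - 1)"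
      using q by (simp add: r_def field_simps)
    then have "1 / q - r / q = (1 - \<alpha>) / (q - 1)"
      using q by (simp flip: diff_divide_distrib)
    ultimately show ?thesis
      using nonzero [of i] unfolding event
      by (simp add: mixture_mass_def q_def [symmetric])
  qed
qed

lemma expected_count_eq_step_operator:
  fixes M :: "nat \<Rightarrow> 'a measure" and L :: "nat \<Rightarrow> 'a \<Rightarrow> int mat"
  defines "q \<equiv> real CARD('p::prime_card)"
  assumes "prob_space (M (Suc n))"
    and L: "iid_lower_triangular N \<xi> (M (Suc n)) (Suc n) (L (Suc n))"
    and xi: "\<xi> \<in> measurable N (count_space UNIV)"
    and mass: "\<And>c. measure N {\<omega> \<in> space N. (of_int (\<xi> \<omega>) :: 'p mod_ring) = c} = mixture_mass r 1 c"
    and b: "\<And>k. b k = mixture_mass r (Suc k) (0 :: 'p mod_ring)"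
  shows "expected_count TYPE('p) M L (Suc n) = (q - 1) * b 0 * (step_operator q b ^^ n) (\<lambda>_. 1) 0"
proof -
  interpret prob_space "M (Suc n)" by fact
  let ?V = "{v \<in> carrier_vec (Suc n). v $ 0 \<noteq> (0 :: 'p mod_ring)}"
  define E where "E v = {\<omega> \<in> space (M (Suc n)). map_mat of_int (L (Suc n) \<omega>) *\<^sub>v v = 0\<^sub>v (Suc n)}"
    for v :: "'p mod_ring vec"
  have fin: "finite ?V"
    by (rule finite_subset [OF _ finite_carrier_vec_finite_type [of "Suc n"]]) auto
  have E: "E v \<in> events"
    "prob (E v) = (\<Prod>i<Suc n. mixture_mass r (card {j. j \<le> i \<and> v $ j \<noteq> 0}) (0 :: 'p mod_ring))"
    if "v \<in> ?V" for v
    unfolding E_def using that prob_in_kernel [OF L _ xi mass] by auto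
  have prefix: "card {j. j \<le> i \<and> v $ j \<noteq> 0} = Suc (tail_weight v i)" if "v \<in> ?V" for v i
  proof -
    have "{j. j \<le> i \<and> v $ j \<noteq> 0} = insert 0 {j. 0 < j \<and> j \<le> i \<and> v $ j \<noteq> 0}"
      using that by auto
    moreover have "finite {j. 0 < j \<and> j \<le> i \<and> v $ j \<noteq> 0}"
      by (rule finite_subset [of _ "{..i}"]) auto
    ultimately show ?thesis by (simp add: tail_weight_def)
  qed
  have "expected_count TYPE('p) M L (Suc n) = expectation (\<lambda>\<omega>. \<Sum>v\<in>?V. indicator (E v) \<omega>)"
    unfolding expected_count_def
  proof (rule Bochner_Integration.integral_cong [OF refl])
    fix \<omega> assume "\<omega> \<in> space (M (Suc n))"
    then have "(\<Sum>v\<in>?V. indicator (E v) \<omega> :: real) = (\<Sum>v\<in>?V. indicator (kernel_vecs (Suc n) (L (Suc n) \<omega>)) v)"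
      by (intro sum.cong) (auto simp: indicator_def kernel_vecs_def E_def)
    also have "\<dots> = real (card (kernel_vecs (Suc n) (L (Suc n) \<omega>) \<inter> ?V))"
      using fin by (simp add: indicator_def sum.If_cases Int_commute)
    also have "kernel_vecs (Suc n) (L (Suc n) \<omega>) \<inter> ?V = kernel_vecs (Suc n) (L (Suc n) \<omega>)"
      by (auto simp: kernel_vecs_def)
    finally show "real (card (kernel_vecs (Suc n) (L (Suc n) \<omega>) :: 'p mod_ring vec set)) =
        (\<Sum>v\<in>?V. indicator (E v) \<omega>)" ..
  qed
  also have "\<dots> = (\<Sum>v\<in>?V. prob (E v))"
    using E(1) by (subst Bochner_Integration.integral_sum) (auto simp: less_top [symmetric])
  also have "\<dots> = (\<Sum>v\<in>?V. (\<Prod>i\<le>n. b (tail_weight v i)) * 1)"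
    by (intro sum.cong refl) (simp add: E(2) prefix b lessThan_Suc_atMost)
  also have "\<dots> = (q - 1) * b 0 * (step_operator q b ^^ n) (\<lambda>_. 1) 0"
    unfolding q_def by (rule sum_vectors_eq_step_operator)
  finally show ?thesis .
qed

section \<open>The infinite product and the limit\<close>

text \<open>
  The factors differ from \<open>1\<close> by \<open>q r\<^sup>i / (1 - r\<^sup>i)\<close> with \<open>i \<ge> 1\<close>, which a geometric series dominates.
\<close>

lemma convergent_prod_geometric_mobius:
  fixes q r :: real
  assumes "\<bar>r\<bar> < 1"
  shows "convergent_prod (\<lambda>i. (1 + (q - 1) * r ^ Suc i) / (1 - r ^ Suc i))"
proof -
  have pow: "\<bar>r\<bar> ^ Suc i \<le> \<bar>r\<bar>" for i
    using assms power_decreasing [of 1 "Suc i" "\<bar>r\<bar>"] by simp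
  have denom: "1 - \<bar>r\<bar> \<le> 1 - r ^ Suc i" for i
    using pow [of i] abs_ge_self [of "r ^ Suc i"] by (simp only: power_abs)
  have "summable (\<lambda>i. norm ((1 + (q - 1) * r ^ Suc i) / (1 - r ^ Suc i) - 1))"
  proof (rule summable_comparison_test')
    show "summable (\<lambda>i. (\<bar>q\<bar> / (1 - \<bar>r\<bar>)) * \<bar>r\<bar> ^ Suc i)"
      using assms by (intro summable_mult, subst summable_Suc_iff) (auto intro: summable_geometric)
    fix i
    have pos: "1 - r ^ Suc i > 0" using denom [of i] assms by linarith
    then have "norm (norm ((1 + (q - 1) * r ^ Suc i) / (1 - r ^ Suc i) - 1)) =
        \<bar>q\<bar> * \<bar>r\<bar> ^ Suc i / (1 - r ^ Suc i)"
    proof -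
      have "(1 + (q - 1) * r ^ Suc i) / (1 - r ^ Suc i) - 1 = q * r ^ Suc i / (1 - r ^ Suc i)"
        using pos by (simp add: field_simps)
      then show ?thesis using pos by (simp add: abs_mult power_abs)
    qed
    also have "\<dots> \<le> \<bar>q\<bar> * \<bar>r\<bar> ^ Suc i / (1 - \<bar>r\<bar>)"
      using denom [of i] assms by (intro divide_left_mono) (auto intro!: mult_pos_pos)
    finally show "norm (norm ((1 + (q - 1) * r ^ Suc i) / (1 - r ^ Suc i) - 1)) \<le>
        (\<bar>q\<bar> / (1 - \<bar>r\<bar>)) * \<bar>r\<bar> ^ Suc i" by simp
  qed
  then show ?thesis
    by (intro abs_convergent_prod_imp_convergent_prod summable_imp_abs_convergent_prod)
qed

theorem lemma3:
  fixes p :: nat and \<alpha> :: real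
    and N :: "'b measure" and \<xi> :: "'b \<Rightarrow> int"
    and M :: "nat \<Rightarrow> 'a measure" and L :: "nat \<Rightarrow> 'a \<Rightarrow> int mat"
  assumes p: "p = CARD('p::prime_card)"
    and N: "prob_space N"
    and xi: "\<xi> \<in> measurable N (count_space UNIV)"
    and alpha: "0 < \<alpha>" "\<alpha> < 1"
    and xi_zero: "prob_space.prob N {\<omega> \<in> space N. [\<xi> \<omega> = 0] (mod int p)} = \<alpha>"
    and xi_nonzero: "\<And>i. i \<in> {1..p - 1} \<Longrightarrow>
      prob_space.prob N {\<omega> \<in> space N. [\<xi> \<omega> = int i] (mod int p)} = (1 - \<alpha>) / (real p - 1)"
    and M: "\<And>n. n \<ge> 1 \<Longrightarrow> prob_space (M n)"
    and L: "\<And>n. n \<ge> 1 \<Longrightarrow> iid_lower_triangular N \<xi> (M n) n (L n)"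
  shows "convergent (expected_count TYPE('p) M L) \<and>
    0 < chi0 TYPE('p) M L \<and>
    convergent_prod (\<lambda>i. (real p - 1) * \<beta> p \<alpha> (Suc i) / (real p - \<beta> p \<alpha> (Suc i))) \<and>
    chi0 TYPE('p) M L = (real p - 1) / real p *
      (\<Prod>i. (real p - 1) * \<beta> p \<alpha> (Suc i) / (real p - \<beta> p \<alpha> (Suc i)))"
proof -
  define q where "q = real p"
  define r where "r = (q * \<alpha> - 1) / (q - 1)"
  define b where "b k = mixture_mass r (Suc k) (0 :: 'p mod_ring)" for k
  define P where "P = (\<Prod>i. (q - 1) * \<beta> p \<alpha> (Suc i) / (q - \<beta> p \<alpha> (Suc i)))"
  have q: "q \<ge> 2" "q = real CARD('p)"
    using prime_card [where 'a = 'p] prime_ge_2_nat by (auto simp: q_def p)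
  have \<beta>: "\<beta> p \<alpha> (Suc k) = 1 + (q - 1) * r ^ Suc k" for k
    by (simp add: \<beta>_def q_def r_def)
  have b: "b k = (1 + (q - 1) * r ^ Suc k) / q" for k
    using q by (simp add: b_def mixture_mass_def field_simps)

  \<comment> \<open>These two bounds are \<open>\<alpha> > 0\<close> and \<open>\<alpha> < 1\<close>. The first is sharper than \<open>r > -1\<close> when \<open>p > 2\<close>, and
    that is what keeps every \<open>\<beta>\<^sub>k\<close> positive.\<close>
  have r_gt: "- 1 < (q - 1) * r" and r_lt: "r < 1"
    using q alpha by (simp_all add: r_def divide_simps)
  have r_abs: "\<bar>r\<bar> < 1"
  proof -
    have "- 1 < r" if "r < 0"
      using mult_right_mono_neg [of 1 "q - 1" r] q(1) that r_gt by linarith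
    then show ?thesis using r_lt by linarith
  qed
  have r_pow_gt: "- 1 < (q - 1) * r ^ Suc k" and r_pow_lt: "r ^ Suc k < 1" for k
  proof -
    have pow: "\<bar>r\<bar> ^ Suc k \<le> \<bar>r\<bar>"
      using r_abs power_decreasing [of 1 "Suc k" "\<bar>r\<bar>"] by simp
    then show "r ^ Suc k < 1"
      using r_abs abs_ge_self [of "r ^ Suc k"] by (simp only: power_abs)
    show "- 1 < (q - 1) * r ^ Suc k"
    proof (cases "0 \<le> r")
      case True
      then have "0 \<le> (q - 1) * r ^ Suc k" using q by (intro mult_nonneg_nonneg) auto
      then show ?thesis by linarith
    next
      case False
      have "r \<le> r ^ Suc k"
        using pow abs_ge_minus_self [of "r ^ Suc k"] False by (simp only: power_abs)
      then have "(q - 1) * r \<le> (q - 1) * r ^ Suc k"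
        using q by (intro mult_left_mono) auto
      then show ?thesis using r_gt by linarith
    qed
  qed
  have b_pos: "0 < b k" and b_lt: "b k < 1" for k
  proof -
    show "0 < b k" using r_pow_gt [of k] q by (simp add: b)
    have "(q - 1) * r ^ Suc k < (q - 1) * 1"
      using r_pow_lt [of k] q by (intro mult_strict_left_mono) auto
    then have "1 + (q - 1) * r ^ Suc k < q"
      by (simp only: mult_1_right less_diff_eq add.commute)
    then show "b k < 1" using q(1) by (simp add: b)
  qed
  have factor: "(q - 1) * \<beta> p \<alpha> (Suc k) / (q - \<beta> p \<alpha> (Suc k)) = (q - 1) * b k / (1 - b k)" for k
  proof -
    have "\<beta> p \<alpha> (Suc k) = q * b k" using q(1) by (simp add: \<beta> b)
    moreover have "q - q * b k = q * (1 - b k)" by (simp add: algebra_simps)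
    ultimately show ?thesis using q(1) by simp
  qed
  have factor': "(q - 1) * b k / (1 - b k) = (1 + (q - 1) * r ^ Suc k) / (1 - r ^ Suc k)" for k
  proof -
    have "1 - b k = (q - 1) * (1 - r ^ Suc k) / q"
      using q by (simp add: b field_simps)
    then show ?thesis using q r_pow_lt [of k] by (simp add: b)
  qed
  have factor_pos: "(q - 1) * b k / (1 - b k) > 0" for k
    using q b_pos [of k] b_lt [of k] by simp

  have conv: "convergent_prod (\<lambda>i. (q - 1) * \<beta> p \<alpha> (Suc i) / (q - \<beta> p \<alpha> (Suc i)))"
    unfolding factor factor' by (rule convergent_prod_geometric_mobius) (rule r_abs)
  have P_lim: "(\<lambda>k. \<Prod>i<k. (q - 1) * b i / (1 - b i)) \<longlonglongrightarrow> P"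
    using convergent_prod_LIMSEQ [OF conv] unfolding P_def LIMSEQ_lessThan_iff_atMost factor .
  have "P \<noteq> 0"
    unfolding P_def using conv factor_pos by (intro prodinf_nonzero) (auto simp: factor less_le)
  moreover have "P \<ge> 0"
    by (rule LIMSEQ_le_const [OF P_lim]) (intro exI allI impI prod_nonneg less_imp_le [OF factor_pos])
  ultimately have P_pos: "P > 0" by simp

  have b_lim: "b \<longlonglongrightarrow> 1 / q"
  proof -
    have "(\<lambda>k. r ^ Suc k) \<longlonglongrightarrow> 0"
      using r_abs by (intro LIMSEQ_Suc LIMSEQ_power_zero) simp
    then have "(\<lambda>k. (1 + (q - 1) * r ^ Suc k) / q) \<longlonglongrightarrow> (1 + (q - 1) * 0) / q"
      using q by (intro tendsto_intros) auto
    then show ?thesis by (simp add: b [abs_def])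
  qed

  have mass: "measure N {\<omega> \<in> space N. (of_int (\<xi> \<omega>) :: 'p mod_ring) = c} = mixture_mass r 1 c" for c
    using mixture_mass_of_uniform_nonzero_residues [where 'p = 'p, of N \<xi> \<alpha> c] xi_zero xi_nonzero
    by (simp add: q_def r_def p)
  have "expected_count TYPE('p) M L (Suc n) = (q - 1) * b 0 * (step_operator q b ^^ n) (\<lambda>_. 1) 0" for n
    unfolding q(2) by (rule expected_count_eq_step_operator [OF _ _ xi mass b_def]) (simp_all add: M L)
  moreover have "(\<lambda>n. (q - 1) * b 0 * (step_operator q b ^^ n) (\<lambda>_. 1) 0)
      \<longlonglongrightarrow> (q - 1) * b 0 * (P / (q * b 0))"
    using q b_pos b_lt b_lim P_lim P_pos by (intro tendsto_mult_left step_operator_funpow_tendsto) auto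
  ultimately have "(\<lambda>n. expected_count TYPE('p) M L (Suc n)) \<longlonglongrightarrow> (q - 1) / q * P"
    using b_pos [of 0] by simp
  then have lim: "expected_count TYPE('p) M L \<longlonglongrightarrow> (q - 1) / q * P"
    by (rule LIMSEQ_imp_Suc)
  then have chi0: "chi0 TYPE('p) M L = (q - 1) / q * P"
    unfolding chi0_def by (rule limI)
  show ?thesis
    using lim chi0 conv P_pos q unfolding q_def P_def
    by (auto simp: convergent_def)
qed

end
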